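(* Let $n\ge 4$. The invariant bending moments $I_3,\dots,I_{n-1}$ of poristic Steiner $n$-chains are algebraically expressible through the first two bending moments $I_1,I_2$. That is, regarding the invariant bending moments as functions of the gauge $(R,r,d)$ of the parent circles, for each $k\in\{3,\dots,n-1\}$ there is a polynomial $P(X,Y,Z)$ with real coefficients, of positive degree in $Z$ and with leading coefficient in $Z$ (a polynomial in $X,Y$) not vanishing identically when evaluated at $(I_1,I_2)$, such that $P(I_1,I_2,I_k)=0$ for all pairs of parent circles of order $n$.
   Context: Let $q=\tan^2(\pi/n)$. A pair of parent circles of order $n$ with the gauge $(R,r,d)$ consists of a circle $\Gamma$ of radius $R$ and a circle $\gamma$ of radius $r<R$ contained in the open disk bounded by $\Gamma$, with distance $d$ between their centers, where $R,r,d>0$ and $d^2=(R-r)^2-4qRr$. A Steiner $n$-chain with these parent circles is a sequence of circles $\delta_1,\dots,\delta_n$, going once around $\gamma$, such that circles with cyclically adjacent indices are externally tangent and each $\delta_i$ is externally tangent to $\gamma$ and internally tangent to $\Gamma$; under the relation $d^2=(R-r)^2-4qRr$ there is a one-parameter family of such chains (poristic Steiner $n$-chains). Bending moments: if $b_1,\dots,b_n>0$ are the curvatures (reciprocals of radii) of the circles of the chain, then $I_k=\sum_{j=1}^n b_j^k$. For $1\le k\le n-1$, $I_k$ does not depend on the choice of the chain with the given parent circles (invariant bending moment), so it is a function of the gauge $(R,r,d)$. *)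

theory Defs
  imports "HOL-Analysis.Analysis" "HOL-Computational_Algebra.Polynomial"
begin

text \<open>The plane is identified with \<^typ>\<open>complex\<close>; a circle is given by its centre and its radius.\<close>

definition externally_tangent :: "complex \<Rightarrow> real \<Rightarrow> complex \<Rightarrow> real \<Rightarrow> bool" where
  "externally_tangent c s c' s' \<longleftrightarrow> dist c c' = s + s'"

text \<open>The circle \<open>(c, s)\<close> lies inside \<open>(C, S)\<close> and touches it.\<close>

definition internally_tangent :: "complex \<Rightarrow> real \<Rightarrow> complex \<Rightarrow> real \<Rightarrow> bool" where
  "internally_tangent c s C S \<longleftrightarrow> s < S \<and> dist c C = S - s"

definition parent_circles ::
    "nat \<Rightarrow> complex \<Rightarrow> complex \<Rightarrow> real \<Rightarrow> real \<Rightarrow> real \<Rightarrow> bool" where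
  "parent_circles n A a R r d \<longleftrightarrow>
     0 < R \<and> 0 < r \<and> 0 < d \<and> r < R \<and>
     sphere a r \<subseteq> ball A R \<and>
     dist A a = d \<and>
     d\<^sup>2 = (R - r)\<^sup>2 - 4 * (tan (pi / real n))\<^sup>2 * R * r"

text \<open>
  Going once around the point \<open>a\<close>, in either direction: polar angles \<open>\<theta> 0, \<dots>, \<theta> (n - 1)\<close> of
  the points \<open>c 0, \<dots>, c (n - 1)\<close> as seen from \<open>a\<close> can be chosen strictly monotone, so
  that returning to \<open>c 0\<close> (with angle \<open>\<theta> n\<close>) completes exactly one full turn.
\<close>

definition goes_once_around :: "nat \<Rightarrow> complex \<Rightarrow> (nat \<Rightarrow> complex) \<Rightarrow> bool" where
  "goes_once_around n a c \<longleftrightarrow>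
     (\<exists>\<theta> :: nat \<Rightarrow> real.
        (\<forall>j<n. c j - a = of_real (dist (c j) a) * cis (\<theta> j)) \<and>
        ((\<forall>j<n. \<theta> j < \<theta> (Suc j)) \<and> \<theta> n = \<theta> 0 + 2 * pi \<or>
         (\<forall>j<n. \<theta> (Suc j) < \<theta> j) \<and> \<theta> n = \<theta> 0 - 2 * pi))"

text \<open>
  The circles of a chain are indexed by \<open>0, \<dots>, n - 1\<close>, cyclically; \<open>c j\<close> and \<open>\<rho> j\<close> are the
  centre and the radius of the \<open>j\<close>-th circle.
\<close>

definition steiner_chain ::
    "nat \<Rightarrow> complex \<Rightarrow> complex \<Rightarrow> real \<Rightarrow> real \<Rightarrow> (nat \<Rightarrow> complex) \<Rightarrow> (nat \<Rightarrow> real) \<Rightarrow> bool" where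
  "steiner_chain n A a R r c \<rho> \<longleftrightarrow>
     (\<forall>j<n. 0 < \<rho> j \<and>
        externally_tangent (c j) (\<rho> j) a r \<and>
        internally_tangent (c j) (\<rho> j) A R \<and>
        externally_tangent (c j) (\<rho> j) (c (Suc j mod n)) (\<rho> (Suc j mod n))) \<and>
     goes_once_around n a c"

definition chain_bending_moment :: "nat \<Rightarrow> (nat \<Rightarrow> real) \<Rightarrow> nat \<Rightarrow> real" where
  "chain_bending_moment n \<rho> k = (\<Sum>j<n. (1 / \<rho> j) ^ k)"

text \<open>
  The invariant bending moment as a function of the gauge: the common value of the \<open>k\<close>-th
  bending moment on all chains whose parent circles have the gauge \<open>(R, r, d)\<close>. The definite
  description is meaningful only where such chains exist and all of them give the same value.
\<close>

definition bending_moment :: "nat \<Rightarrow> nat \<Rightarrow> real \<Rightarrow> real \<Rightarrow> real \<Rightarrow> real" where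
  "bending_moment n k R r d =
     (THE s. \<exists>A a c \<rho>. parent_circles n A a R r d \<and> steiner_chain n A a R r c \<rho> \<and>
        s = chain_bending_moment n \<rho> k)"

text \<open>
  A polynomial in \<open>X, Y\<close> is an element of \<open>\<real>[X][Y]\<close>, and a polynomial in \<open>X, Y, Z\<close> is an
  element of \<open>\<real>[X][Y][Z]\<close>; thus \<^const>\<open>degree\<close> and \<^const>\<open>lead_coeff\<close> of the latter refer
  to the variable \<open>Z\<close>.
\<close>

definition eval2 :: "real poly poly \<Rightarrow> real \<Rightarrow> real \<Rightarrow> real" where
  "eval2 Q x y = poly (poly Q [:y:]) x"

definition eval3 :: "real poly poly poly \<Rightarrow> real \<Rightarrow> real \<Rightarrow> real \<Rightarrow> real" where
  "eval3 P x y z = eval2 (poly P [:[:z:]:]) x y"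

end

theory Submission
  imports Defs
begin

text \<open>
  Put the centre of \<open>\<gamma>\<close> at the origin and that of \<open>\<Gamma>\<close> at \<open>(d, 0)\<close>. For a circle of
  curvature \<open>b\<close> with centre \<open>(x, y)\<close> that touches both parents, \<open>b x\<close> is an affine function
  of \<open>b\<close>, and \<open>(b, b y)\<close> lies on the ellipse \<open>D (b - p)\<^sup>2 + (b y)\<^sup>2 = D N\<^sup>2\<close>, so
  \<open>b = p - N cos \<psi>\<close>. Mutual tangency is the polar form of this ellipse and fixes
  \<open>cos (\<psi> - \<psi>')\<close>; the relation between \<open>R, r, d\<close> makes it \<open>cos (2\<pi>/n)\<close>. Since a chain
  does not backtrack, its curvatures are \<open>p - N cos (\<phi> + 2\<pi>j/n)\<close>, and for \<open>k < n\<close> their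
  \<open>k\<close>-th power sum is a polynomial in \<open>p\<close> and \<open>N\<^sup>2\<close> not involving \<open>\<phi>\<close>. As
  \<open>I\<^sub>1 = n p\<close> and \<open>I\<^sub>2 = n (p\<^sup>2 + N\<^sup>2/2)\<close>, every \<open>I\<^sub>k\<close> is a polynomial in \<open>I\<^sub>1, I\<^sub>2\<close>.
\<close>

section \<open>Power sums over equidistant angles\<close>

text \<open>A geometric sum with ratio \<open>w = cis (2 * pi * m / n)\<close>: here
  \<open>w ^ n = 1\<close>, and \<open>w \<noteq> 1\<close> because \<open>n\<close> does not divide
  \<open>m\<close>.\<close>

lemma sum_cis_multiples:
  fixes n :: nat and m :: int
  assumes "0 < n" and "\<not> int n dvd m"
  shows "(\<Sum>j<n. cis (2 * pi * of_int m * real j / real n)) = 0"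
proof -
  define w where "w = cis (2 * pi * of_int m / real n)"
  have "w ^ n = 1"
    using assms(1) by (simp add: w_def Complex.DeMoivre)
  moreover have "w \<noteq> 1"
  proof
    assume "w = 1"
    then have "cos (2 * pi * of_int m / real n) = 1"
      by (simp add: w_def complex_eq_iff)
    then obtain l :: int where "2 * pi * of_int m / real n = of_int l * 2 * pi"
      by (auto simp: cos_one_2pi_int)
    then have "real_of_int m = of_int (l * int n)"
      using assms(1) by (simp add: field_simps)
    then have "m = l * int n"
      by (simp only: of_int_eq_iff)
    then show False
      using assms(2) by simp
  qed
  ultimately have "(\<Sum>j<n. w ^ j) = 0"
    by (simp add: sum_gp_strict)
  then show ?thesis
    by (simp add: w_def Complex.DeMoivre mult_ac)
qed

text \<open>Writing the cosine as \<open>(cis x + cis (- x)) / 2\<close> turns its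
  \<open>i\<close>-th power into a combination of the frequencies \<open>2 * l - i\<close>. They
  have absolute value at most \<open>i < n\<close>, so summation over the \<open>n\<close> angles
  kills all but frequency zero, which occurs only for \<open>i = 2 * l\<close>.\<close>

lemma sum_cos_power_equidistant:
  fixes n i :: nat and \<phi> :: real
  assumes "i < n"
  shows "(\<Sum>j<n. cos (\<phi> + 2 * pi * real j / real n) ^ i) =
    (if even i then real n * real (i choose (i div 2)) / 2 ^ i else 0)"
proof -
  define u where "u j = \<phi> + 2 * pi * real j / real n" for j
  have expand: "complex_of_real (cos x ^ i) =
      (\<Sum>l\<le>i. of_nat (i choose l) / 2 ^ i * cis ((2 * real l - real i) * x))" for x
  proof -
    have "complex_of_real (cos x) = (cis x + cis (- x)) / 2"
      by (simp add: complex_eq_iff)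
    then have "complex_of_real (cos x ^ i) = (cis x + cis (- x)) ^ i / 2 ^ i"
      unfolding of_real_power by (simp only: power_divide)
    also have "\<dots> = (\<Sum>l\<le>i. of_nat (i choose l) * cis x ^ l * cis (- x) ^ (i - l)) / 2 ^ i"
      by (simp add: binomial_ring)
    also have "\<dots> = (\<Sum>l\<le>i. of_nat (i choose l) / 2 ^ i * cis ((2 * real l - real i) * x))"
      unfolding sum_divide_distrib
    proof (rule sum.cong)
      fix l assume "l \<in> {..i}"
      then have "cis x ^ l * cis (- x) ^ (i - l) = cis ((2 * real l - real i) * x)"
        by (simp only: Complex.DeMoivre cis_mult) (simp add: of_nat_diff algebra_simps)
      then show "of_nat (i choose l) * cis x ^ l * cis (- x) ^ (i - l) / 2 ^ i =
          of_nat (i choose l) / 2 ^ i * cis ((2 * real l - real i) * x)"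
        by (simp add: mult.assoc)
    qed simp
    finally show ?thesis .
  qed
  have inner: "(\<Sum>j<n. cis ((2 * real l - real i) * u j)) = (if 2 * l = i then of_nat n else 0)"
    if "l \<le> i" for l
  proof (cases "2 * l = i")
    case True
    then have 0: "2 * real l - real i = 0" by auto
    show ?thesis unfolding 0 using True by simp
  next
    case False
    define m where "m = 2 * int l - int i"
    have "m \<noteq> 0" "\<bar>m\<bar> < int n"
      using False that assms by (auto simp: m_def)
    then have "\<not> int n dvd m"
      using dvd_imp_le_int by force
    then have 0: "(\<Sum>j<n. cis (2 * pi * of_int m * real j / real n)) = 0"
      using sum_cis_multiples assms by auto
    have "cis ((2 * real l - real i) * u j) =
        cis ((2 * real l - real i) * \<phi>) * cis (2 * pi * of_int m * real j / real n)" for j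
      by (simp add: cis_mult u_def m_def algebra_simps diff_divide_distrib add_divide_distrib)
    then show ?thesis
      using False 0 by (simp flip: sum_distrib_left)
  qed
  have "complex_of_real (\<Sum>j<n. cos (u j) ^ i) =
      (\<Sum>l\<le>i. of_nat (i choose l) / 2 ^ i * (\<Sum>j<n. cis ((2 * real l - real i) * u j)))"
    unfolding of_real_sum expand by (subst sum.swap) (simp add: sum_distrib_left)
  also have "\<dots> = (\<Sum>l\<le>i. if 2 * l = i then of_nat (i choose l) / 2 ^ i * of_nat n else 0)"
    by (intro sum.cong) (auto simp: inner)
  also have "\<dots> = complex_of_real (if even i then real n * real (i choose (i div 2)) / 2 ^ i else 0)"
  proof (cases "even i")
    case True
    then have "2 * l = i \<longleftrightarrow> l = i div 2" for l by auto
    then show ?thesis using True by simp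
  next
    case False
    then have "2 * l \<noteq> i" for l by auto
    then show ?thesis using False by simp
  qed
  finally show ?thesis
    unfolding of_real_eq_iff u_def .
qed

text \<open>The map \<open>h\<close> embeds the real coefficients, so that the same sum can be taken in \<open>\<real>[X][Y]\<close>.\<close>

definition moment_sum :: "nat \<Rightarrow> ('a::comm_ring_1) \<Rightarrow> 'a \<Rightarrow> (real \<Rightarrow> 'a) \<Rightarrow> 'a" where
  "moment_sum k p w h = (\<Sum>i\<le>k. if even i
     then h (real ((k choose i) * (i choose (i div 2))) / 2 ^ i) * p ^ (k - i) * w ^ (i div 2)
     else 0)"

text \<open>Binomial expansion of each summand: odd powers of the cosine sum to zero, so only even
  powers of \<open>N\<close> remain and \<open>\<phi>\<close> drops out.\<close>

lemma sum_power_equidistant: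
  fixes n k :: nat and p N \<phi> :: real
  assumes "k < n"
  shows "(\<Sum>j<n. (p - N * cos (\<phi> + 2 * pi * real j / real n)) ^ k) =
    real n * moment_sum k p (N\<^sup>2) (\<lambda>x. x)"
proof -
  define u where "u j = \<phi> + 2 * pi * real j / real n" for j
  have "(\<Sum>j<n. (p - N * cos (u j)) ^ k) =
      (\<Sum>j<n. \<Sum>i\<le>k. real (k choose i) * (- N) ^ i * p ^ (k - i) * cos (u j) ^ i)"
  proof (rule sum.cong)
    fix j
    have "(p - N * cos (u j)) ^ k = ((- N) * cos (u j) + p) ^ k"
      by (simp add: algebra_simps)
    then show "(p - N * cos (u j)) ^ k =
        (\<Sum>i\<le>k. real (k choose i) * (- N) ^ i * p ^ (k - i) * cos (u j) ^ i)"
      unfolding binomial_ring power_mult_distrib by (simp add: mult_ac)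
  qed simp
  also have "\<dots> = (\<Sum>i\<le>k. real (k choose i) * (- N) ^ i * p ^ (k - i) * (\<Sum>j<n. cos (u j) ^ i))"
    by (subst sum.swap) (simp add: sum_distrib_left)
  also have "\<dots> = real n * moment_sum k p (N\<^sup>2) (\<lambda>x. x)"
    unfolding moment_sum_def sum_distrib_left[of "real n"]
  proof (rule sum.cong)
    fix i assume "i \<in> {..k}"
    then have "i < n" using assms by simp
    note S = sum_cos_power_equidistant[OF this, of \<phi>, folded u_def]
    show "real (k choose i) * (- N) ^ i * p ^ (k - i) * (\<Sum>j<n. cos (u j) ^ i) =
      real n * (if even i
        then real ((k choose i) * (i choose (i div 2))) / 2 ^ i * p ^ (k - i) * (N\<^sup>2) ^ (i div 2)
        else 0)"
      unfolding S by (auto simp flip: power_mult)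
  qed simp
  finally show ?thesis unfolding u_def .
qed

section \<open>Steps on the unit circle, turning once around a point, and a Blaschke boundary
  map\<close>

lemma unimodular_eq_cis:
  assumes "norm z = 1" and "Re z = cos h"
  shows "z = cis h \<or> z = cis (- h)"
proof -
  have "(Re z)\<^sup>2 + (Im z)\<^sup>2 = 1"
    using assms(1) by (simp add: cmod_def)
  then have "(Im z)\<^sup>2 = (sin h)\<^sup>2"
    using sin_cos_squared_add[of h] assms(2) by algebra
  then show ?thesis
    using assms(2) by (auto simp: power2_eq_iff complex_eq_iff)
qed

text \<open>The sign of the first step persists: a change of sign would bring
  \<open>u (Suc (Suc j))\<close> back to \<open>u j\<close>, against injectivity.\<close>

lemma steps_without_backtracking:
  fixes u :: "nat \<Rightarrow> complex" and h :: real
  assumes step: "\<And>j. Suc j < n \<Longrightarrow> u (Suc j) = u j * cis h \<or> u (Suc j) = u j * cis (- h)"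
    and inj: "inj_on u {..<n}"
  shows "\<exists>s\<in>{1, - 1}. \<forall>j<n. u j = u 0 * cis (s * real j * h)"
proof (cases "1 < n")
  case False
  then show ?thesis by (auto simp: not_less le_Suc_eq)
next
  case True
  obtain s :: real where s: "s \<in> {1, - 1}" "u 1 = u 0 * cis (s * h)"
    using step[of 0] True that[of 1] that[of "- 1"] by auto
  have S: "u (Suc j) = u j * cis (s * h)" if "Suc j < n" for j
    using that
  proof (induction j)
    case 0
    then show ?case using s by simp
  next
    case (Suc j)
    have "u (Suc (Suc j)) \<noteq> u j"
      using Suc.prems inj by (auto dest!: inj_onD)
    moreover have "u (Suc j) = u j * cis (s * h)"
      using Suc by simp
    ultimately have "u (Suc (Suc j)) \<noteq> u (Suc j) * cis (- s * h)"
      by (simp add: mult.assoc cis_mult)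
    then show ?case
      using step[OF Suc.prems] s(1) by auto
  qed
  have "u j = u 0 * cis (s * real j * h)" if "j < n" for j
    using that
  proof (induction j)
    case 0
    then show ?case by simp
  next
    case (Suc j)
    then show ?case
      using S[of j] by (simp add: mult.assoc cis_mult algebra_simps)
  qed
  then show ?thesis using s(1) by blast
qed

text \<open>Polar angles at two different indices differ by a nonzero amount smaller than a full
  turn, so the centres lie in different directions from \<open>a\<close>. This supplies the
  injectivity that excludes backtracking.\<close>

lemma centres_distinct:
  assumes "goes_once_around n a c" and "\<And>j. j < n \<Longrightarrow> c j \<noteq> a"
  shows "inj_on c {..<n}"
proof -
  obtain \<theta> where polar: "\<And>j. j < n \<Longrightarrow> c j - a = of_real (dist (c j) a) * cis (\<theta> j)"
    and turn: "(\<forall>j<n. \<theta> j < \<theta> (Suc j)) \<and> \<theta> n = \<theta> 0 + 2 * pi \<or>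
         (\<forall>j<n. \<theta> (Suc j) < \<theta> j) \<and> \<theta> n = \<theta> 0 - 2 * pi"
    using assms(1) unfolding goes_once_around_def by blast
  \<comment> \<open>Kept general in \<open>f\<close>, so that it also serves for
    \<open>- \<theta>\<close> when the chain runs clockwise.\<close>
  have inc: "f i < f j" if "\<forall>j<n. f j < f (Suc j)" "i < j" "j \<le> n" for f :: "nat \<Rightarrow> real" and i j
    using that(2,3)
  proof (induction j)
    case (Suc j)
    then show ?case using that(1)
      by (cases "i = j") (auto intro: less_trans)
  qed simp
  have bound: "0 < \<bar>\<theta> j - \<theta> i\<bar> \<and> \<bar>\<theta> j - \<theta> i\<bar> < 2 * pi" if "i < j" "j < n" for i j
    using turn
  proof
    assume *: "(\<forall>j<n. \<theta> j < \<theta> (Suc j)) \<and> \<theta> n = \<theta> 0 + 2 * pi"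
    have "\<theta> i < \<theta> j" "\<theta> j < \<theta> n" "\<theta> 0 \<le> \<theta> i"
      using inc[of \<theta> i j] inc[of \<theta> j n] inc[of \<theta> 0 i] that * by (cases "i = 0"; auto)+
    then show ?thesis using * by linarith
  next
    assume *: "(\<forall>j<n. \<theta> (Suc j) < \<theta> j) \<and> \<theta> n = \<theta> 0 - 2 * pi"
    have "\<theta> j < \<theta> i" "\<theta> n < \<theta> j" "\<theta> i \<le> \<theta> 0"
      using inc[of "\<lambda>j. - \<theta> j" i j] inc[of "\<lambda>j. - \<theta> j" j n] inc[of "\<lambda>j. - \<theta> j" 0 i] that *
      by (cases "i = 0"; auto)+
    then show ?thesis using * by linarith
  qed
  have "c i \<noteq> c j" if "i < j" "j < n" for i j
  proof
    assume eq: "c i = c j"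
    have "cis (\<theta> i) = cis (\<theta> j)"
      using polar[of i] polar[of j] assms(2)[of j] that eq by auto
    then have "cos (\<theta> j - \<theta> i) = 1"
      by (simp add: complex_eq_iff cos_diff flip: power2_eq_square)
    then obtain m :: int where "\<theta> j - \<theta> i = of_int m * 2 * pi"
      by (auto simp: cos_one_2pi_int)
    then have "0 < \<bar>real_of_int m\<bar>" "\<bar>real_of_int m\<bar> < 1"
      using bound[OF that] by (auto simp: abs_mult)
    then show False by simp
  qed
  then show ?thesis
    by (metis inj_onI lessThan_iff linorder_neqE_nat)
qed

text \<open>The boundary map of a Blaschke factor, lifted to the angle.\<close>

lemma blaschke_angle:
  fixes \<kappa> :: real
  assumes "0 < \<kappa>" and "\<kappa> < 1"
  obtains g :: "real \<Rightarrow> real" where "strict_mono g" and "\<And>x. g (x + 2 * pi) = g x + 2 * pi"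
    and "\<And>x. cos (g x) = (cos x - \<kappa>) / (1 - \<kappa> * cos x)"
    and "\<And>x. sin (g x) = sqrt (1 - \<kappa>\<^sup>2) * sin x / (1 - \<kappa> * cos x)"
proof -
  define s where "s = sqrt (1 - \<kappa>\<^sup>2)"
  have k1: "\<kappa>\<^sup>2 < 1" using assms by (simp add: abs_square_less_1)
  have s: "0 < s" "s\<^sup>2 = 1 - \<kappa>\<^sup>2" "s < 1"
    using k1 assms by (auto simp: s_def real_sqrt_lt_1_iff)
  \<comment> \<open>\<open>e\<close> is the root in (0, 1) of
    \<open>\<kappa> = 2 * e / (1 + e^2)\<close>; correspondingly
    \<open>s = (1 - e^2) / (1 + e^2)\<close>.\<close>
  define e where "e = (1 - s) / \<kappa>"
  have ks: "(1 + s) * (1 - s) = \<kappa>\<^sup>2" using s(2) by algebra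
  have e1: "(1 + s) * (1 + e\<^sup>2) = 2"
    using ks s assms unfolding e_def power_divide by (simp add: field_simps) algebra
  have e2: "(1 + s) * e = \<kappa>"
    using ks assms unfolding e_def by (simp add: field_simps power2_eq_square)
  have e3: "(1 + s) * (1 - e\<^sup>2) = 2 * s" using e1 by (simp add: algebra_simps)
  have e0: "0 < e" using s assms by (simp add: e_def)
  have "0 < (1 + s) * (1 - e\<^sup>2)" using e3 s by simp
  then have el: "e\<^sup>2 < 1" using s by (simp add: zero_less_mult_iff)
  then have el1: "e < 1" using e0 by (simp add: power2_less_1_iff)
  have pos: "0 < 1 - e * cos x" for x
  proof -
    have "e * cos x \<le> e * 1" using e0 by (intro mult_left_mono) auto
    then show ?thesis using el1 by linarith
  qed
  \<comment> \<open>With \<open>z = cis x\<close>, \<open>g x\<close> is a continuous argument of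
    \<open>(z - e) / (1 - e * z)\<close>: the arctangent is the argument of
    \<open>1 - e * cnj z\<close>, whose real part is positive.\<close>
  define g where "g x = x + 2 * arctan (e * sin x / (1 - e * cos x))" for x
  \<comment> \<open>\<open>q x\<close> is the squared modulus of \<open>1 - e * cis x\<close>. The
    derivative of \<open>g\<close> is then the Poisson kernel \<open>(1 - e^2) / q x\<close>, which
    is positive.\<close>
  define q where "q x = (1 - e * cos x)\<^sup>2 + (e * sin x)\<^sup>2" for x
  have q0: "0 < q x" for x unfolding q_def using pos[of x] by (simp add: add_pos_nonneg)
  have q': "q x = 1 + e\<^sup>2 - 2 * e * cos x" for x
    unfolding q_def using sin_cos_squared_add[of x] by algebra
  have qk: "(1 + s) * q x = 2 * (1 - \<kappa> * cos x)" for x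
  proof -
    have "(1 + s) * q x = (1 + s) * (1 + e\<^sup>2) - 2 * ((1 + s) * e) * cos x"
      unfolding q' by (simp add: algebra_simps)
    then show ?thesis unfolding e1 e2 by simp
  qed
  have deriv: "(g has_real_derivative (1 - e\<^sup>2) / q x) (at x)" for x
  proof -
    have nz: "1 - e * cos x \<noteq> 0" using pos[of x] by simp
    have sum: "1 + (e * sin x / (1 - e * cos x))\<^sup>2 = q x / (1 - e * cos x)\<^sup>2"
      using nz by (simp add: q_def power_divide field_simps)
    have "(g has_real_derivative 1 + 2 * (inverse (1 + (e * sin x / (1 - e * cos x))\<^sup>2) *
        ((e * cos x * (1 - e * cos x) - e * sin x * (e * sin x)) / ((1 - e * cos x) * (1 - e * cos x))))) (at x)"
      unfolding g_def using nz by (auto intro!: derivative_eq_intros)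
    also have "1 + 2 * (inverse (1 + (e * sin x / (1 - e * cos x))\<^sup>2) *
        ((e * cos x * (1 - e * cos x) - e * sin x * (e * sin x)) / ((1 - e * cos x) * (1 - e * cos x)))) =
        1 + 2 * (e * cos x * (1 - e * cos x) - e * sin x * (e * sin x)) / q x"
    proof -
      have cancel: "inverse (b / v\<^sup>2) * (w / (v * v)) = w / b" if "v \<noteq> 0" for b v w :: real
        using that by (simp add: power2_eq_square)
      show ?thesis unfolding sum cancel[OF nz] by simp
    qed
    also have "\<dots> = (1 - e\<^sup>2) / q x"
    proof -
      have "q x + 2 * (e * cos x * (1 - e * cos x) - e * sin x * (e * sin x)) = 1 - e\<^sup>2"
        unfolding q' using sin_cos_squared_add[of x] by algebra
      then show ?thesis using q0[of x] by (simp add: field_simps)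
    qed
    finally show ?thesis .
  qed
  have "strict_mono g"
  proof (rule strict_monoI)
    fix x y :: real assume "x < y"
    then show "g x < g y"
      by (rule DERIV_pos_imp_increasing) (use deriv el q0 in \<open>auto intro!: exI divide_pos_pos\<close>)
  qed
  moreover have "g (x + 2 * pi) = g x + 2 * pi" for x
    by (simp add: g_def)
  moreover have trig: "cos (g x) = (cos x - \<kappa>) / (1 - \<kappa> * cos x) \<and>
      sin (g x) = s * sin x / (1 - \<kappa> * cos x)" for x
  proof -
    define t where "t = arctan (e * sin x / (1 - e * cos x))"
    have nz: "1 - e * cos x \<noteq> 0" using pos[of x] by simp
    have "0 < cos t" unfolding t_def by (simp add: cos_arctan add_pos_nonneg)
    have tt: "sin t * (1 - e * cos x) = cos t * (e * sin x)"
    proof -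
      have "tan t = e * sin x / (1 - e * cos x)" by (simp add: t_def tan_arctan)
      then show ?thesis using \<open>0 < cos t\<close> nz by (simp add: tan_def field_simps)
    qed
    \<comment> \<open>The three products \<open>c2\<close>, \<open>sc\<close> and \<open>s2\<close>
      are what the double-angle formulas for \<open>2 * t\<close> require; scaling by
      \<open>q x\<close> avoids square roots.\<close>
    have c2: "(cos t)\<^sup>2 * q x = (1 - e * cos x)\<^sup>2"
      using tt sin_cos_squared_add[of t] unfolding q_def by algebra
    have "(1 - e * cos x) * (sin t * cos t * q x) = (1 - e * cos x) * ((1 - e * cos x) * (e * sin x))"
      using tt c2 by algebra
    then have sc: "sin t * cos t * q x = (1 - e * cos x) * (e * sin x)"
      using nz by simp
    have s2: "(sin t)\<^sup>2 * q x = (e * sin x)\<^sup>2"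
      using c2 sin_cos_squared_add[of t] unfolding q_def by algebra
    have C: "cos (g x) * q x = (1 + e\<^sup>2) * cos x - 2 * e"
    proof -
      have "cos (g x) * q x = cos x * ((cos t)\<^sup>2 * q x - (sin t)\<^sup>2 * q x) - 2 * sin x * (sin t * cos t * q x)"
        unfolding g_def t_def[symmetric] cos_add cos_double sin_double by algebra
      also have "\<dots> = (1 + e\<^sup>2) * cos x - 2 * e"
        unfolding c2 s2 sc using sin_cos_squared_add[of x] by algebra
      finally show ?thesis .
    qed
    have S: "sin (g x) * q x = (1 - e\<^sup>2) * sin x"
    proof -
      have "sin (g x) * q x = sin x * ((cos t)\<^sup>2 * q x - (sin t)\<^sup>2 * q x) + 2 * cos x * (sin t * cos t * q x)"
        unfolding g_def t_def[symmetric] sin_add cos_double sin_double by algebra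
      also have "\<dots> = (1 - e\<^sup>2) * sin x"
        unfolding c2 s2 sc using sin_cos_squared_add[of x] by algebra
      finally show ?thesis .
    qed
    have "cos (g x) * (2 * (1 - \<kappa> * cos x)) = 2 * (cos x - \<kappa>)"
      using C e1 e2 unfolding qk[symmetric] by algebra
    moreover have "sin (g x) * (2 * (1 - \<kappa> * cos x)) = 2 * (s * sin x)"
      using S e3 unfolding qk[symmetric] by algebra
    moreover have "0 < 1 - \<kappa> * cos x"
      using qk[of x] q0[of x] s(1) by (metis add_pos_pos less_numeral_extra(1) mult_pos_pos zero_less_mult_pos zero_less_numeral)
    ultimately show ?thesis by (simp add: field_simps)
  qed
  ultimately show ?thesis
    using that unfolding s_def by blast
qed

section \<open>Constants of the gauge and tangency in terms of curvatures\<close>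

locale steiner_gauge =
  fixes n :: nat and R r d :: real
  assumes n: "3 \<le> n"
    and pos: "0 < R" "0 < r" "0 < d" "r < R"
    and gauge: "d\<^sup>2 = (R - r)\<^sup>2 - 4 * (tan (pi / real n))\<^sup>2 * R * r"
begin

text \<open>Subtracting the two equations of tangency to the parents gives
  \<open>x = be * \<rho> - al\<close>. Inserting this into \<open>x^2 + y^2 = (r + \<rho>)^2\<close>
  and dividing by \<open>\<rho>^2\<close> leaves a quadratic in \<open>b = 1 / \<rho>\<close> with
  leading coefficient \<open>D\<close>; completing the square produces the centre \<open>p\<close>
  and the semi-axis \<open>N\<close>.\<close>

definition al :: real where "al = (R\<^sup>2 - r\<^sup>2 - d\<^sup>2) / (2 * d)"
definition be :: real where "be = (R + r) / d"
definition D :: real where "D = al\<^sup>2 - r\<^sup>2"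
definition p :: real where "p = (r + al * be) / D"
definition N :: real where "N = (r * be + al) / D"

lemma angle: "0 < pi / real n" "pi / real n < pi / 2"
  using n divide_strict_left_mono[of 2 "real n" pi] by auto

text \<open>The tangent is positive, so the gauge relation makes \<open>d\<close> smaller than
  \<open>R - r\<close>.\<close>

lemma d_less: "d + r < R"
proof -
  have "0 < tan (pi / real n)"
    using angle by (rule tan_gt_zero)
  then have "d\<^sup>2 < (R - r)\<^sup>2"
    unfolding gauge using pos by simp
  then have "d < R - r"
    by (rule power2_less_imp_less) (use pos in simp)
  then show ?thesis by simp
qed

lemma d_al: "2 * d * al = R\<^sup>2 - r\<^sup>2 - d\<^sup>2" and d_be: "d * be = R + r"
  using pos by (auto simp: al_def be_def)

lemma al_gt: "r < al"
proof -
  have "(d + r)\<^sup>2 < R\<^sup>2"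
    using d_less pos by (intro power_strict_mono) auto
  then show ?thesis
    using pos by (simp add: al_def less_divide_eq power2_eq_square algebra_simps)
qed

lemma be_gt: "1 < be"
  using d_less pos by (simp add: be_def)

lemma D_pos: "0 < D"
  using al_gt pos by (simp add: D_def power_strict_mono)

lemma D_p: "D * p = r + al * be" and D_N: "D * N = r * be + al"
  using D_pos by (auto simp: p_def N_def)

lemma N_pos: "0 < N"
  using D_pos al_gt be_gt pos by (simp add: N_def add_pos_pos)

text \<open>\<open>D * (p - N)\<close> factors as \<open>(al - r) * (be - 1)\<close>. The inequality
  keeps every curvature \<open>p - N * cos t\<close> positive.\<close>

lemma N_less_p: "N < p"
proof -
  have "0 < (al - r) * (be - 1)"
    using al_gt be_gt by simp
  also have "\<dots> = D * p - D * N"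
    unfolding D_p D_N by algebra
  finally show ?thesis
    using D_pos by simp
qed

lemma cancel_D: "D * x = D * y \<Longrightarrow> x = y"
  using D_pos by simp

text \<open>With \<open>al_p\<close>, this rewrites both sides of the polar form at
  \<open>b = p - N * cos t\<close>: \<open>r * b + 1 = N * (al - r * cos t)\<close> and
  \<open>be - al * b = N * (al * cos t - r)\<close>. Their quotient is the cosine of the polar angle
  of the centre.\<close>

lemma r_p: "r * p + 1 = al * N"
proof (rule cancel_D)
  have "D * (r * p + 1) = r * (D * p) + D"
    by (simp add: algebra_simps)
  also have "\<dots> = al * (D * N)"
    unfolding D_p D_N unfolding D_def by algebra
  finally show "D * (r * p + 1) = D * (al * N)"
    by (simp add: algebra_simps)
qed

lemma al_p: "be - al * p = - (r * N)"
proof (rule cancel_D)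
  have "D * (be - al * p) = be * D - al * (D * p)"
    by (simp add: algebra_simps)
  also have "\<dots> = - (r * (D * N))"
    unfolding D_p D_N unfolding D_def by algebra
  finally show "D * (be - al * p) = D * - (r * N)"
    by (simp add: algebra_simps)
qed

text \<open>With \<open>q\<close> the squared tangent, the gauge relation collapses
  \<open>d * (D * N)\<close> and \<open>d^2 * D\<close> to monomials in \<open>R\<close>,
  \<open>r\<close>, \<open>q\<close> and \<open>1 + q\<close>. Dividing the square of the first by
  the second leaves \<open>D * N^2 = (1 + q) / q\<close>.\<close>

lemma semiaxes: "D * N\<^sup>2 = 1 / (sin (pi / real n))\<^sup>2"
proof -
  define q where "q = (tan (pi / real n))\<^sup>2"
  have cs: "0 < cos (pi / real n)" "0 < sin (pi / real n)"
    using angle by (auto intro: cos_gt_zero sin_gt_zero2)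
  have q: "(1 + q) / q = 1 / (sin (pi / real n))\<^sup>2" "0 < q"
    using cs by (auto simp: q_def tan_def field_simps)
  have g: "d\<^sup>2 = (R - r)\<^sup>2 - 4 * q * R * r"
    using gauge by (simp add: q_def)
  have "2 * (d * (D * N)) = 2 * r * (d * be) + 2 * d * al"
    unfolding D_N by algebra
  also have "\<dots> = 4 * R * r * (1 + q)"
    unfolding d_al d_be g by algebra
  finally have DN: "d * (D * N) = 2 * R * r * (1 + q)"
    by simp
  have "4 * (d\<^sup>2 * D) = (2 * d * al)\<^sup>2 - 4 * d\<^sup>2 * r\<^sup>2"
    unfolding D_def by algebra
  also have "\<dots> = 16 * R\<^sup>2 * r\<^sup>2 * q * (1 + q)"
    unfolding d_al g by algebra
  finally have DD: "d\<^sup>2 * D = 4 * R\<^sup>2 * r\<^sup>2 * q * (1 + q)"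
    by (simp add: mult_ac)
  have "(d\<^sup>2 * D) * (D * N\<^sup>2) = (d * (D * N))\<^sup>2"
    by algebra
  then have "(4 * R\<^sup>2 * r\<^sup>2 * q * (1 + q)) * (D * N\<^sup>2) = (2 * R * r * (1 + q))\<^sup>2"
    unfolding DN DD .
  then have "(4 * R\<^sup>2 * r\<^sup>2 * (1 + q)) * (q * (D * N\<^sup>2)) = (4 * R\<^sup>2 * r\<^sup>2 * (1 + q)) * (1 + q)"
    by algebra
  then have "q * (D * N\<^sup>2) = 1 + q"
    using pos q(2) by simp
  then have "D * N\<^sup>2 = (1 + q) / q"
    using q(2) by (simp add: eq_divide_eq mult.commute)
  then show ?thesis
    unfolding q(1) .
qed

text \<open>Rescaled to the unit circle, tangency of neighbours fixes the cosine of their angular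
  difference as the right-hand side; the value found in \<open>semiaxes\<close> identifies the step
  as \<open>2 * pi / n\<close>.\<close>

lemma cos_step: "cos (2 * pi / real n) = 1 - 2 / (D * N\<^sup>2)"
  using cos_double_sin[of "pi / real n"] unfolding semiaxes by simp

text \<open>The diagonal \<open>b = b'\<close> is the equation of the ellipse, the general case its
  polarization, which governs mutual tangency.\<close>

lemma polar_conic:
  "(r * b + 1) * (r * b' + 1) - (be - al * b) * (be - al * b') =
    D * N\<^sup>2 - D * (b - p) * (b' - p)"
proof -
  have "D * (D * (p\<^sup>2 - N\<^sup>2)) = (D * p)\<^sup>2 - (D * N)\<^sup>2"
    by algebra
  also have "\<dots> = D * (be\<^sup>2 - 1)"
    unfolding D_p D_N unfolding D_def by algebra
  finally have pN: "D * (p\<^sup>2 - N\<^sup>2) = be\<^sup>2 - 1"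
    by (rule cancel_D)
  have "D * N\<^sup>2 - D * (b - p) * (b' - p) = (D * p) * (b + b') - D * b * b' - D * (p\<^sup>2 - N\<^sup>2)"
    by algebra
  also have "\<dots> = (r * b + 1) * (r * b' + 1) - (be - al * b) * (be - al * b')"
    unfolding D_p pN unfolding D_def by algebra
  finally show ?thesis by simp
qed

text \<open>The difference of the two circle equations is the affine relation for \<open>x\<close>;
  given that relation, \<open>polar_conic\<close> on the diagonal turns the first equation into the
  ellipse.\<close>

lemma tangent_to_parents_iff:
  assumes "0 < \<rho>"
  shows "x\<^sup>2 + y\<^sup>2 = (r + \<rho>)\<^sup>2 \<and> (x - d)\<^sup>2 + y\<^sup>2 = (R - \<rho>)\<^sup>2 \<longleftrightarrow>
    x / \<rho> = be - al / \<rho> \<and> D * (1 / \<rho> - p)\<^sup>2 + (y / \<rho>)\<^sup>2 = D * N\<^sup>2"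
proof -
  have 1: "x / \<rho> = be - al / \<rho> \<longleftrightarrow> 2 * d * x = r\<^sup>2 + d\<^sup>2 - R\<^sup>2 + 2 * \<rho> * (r + R)"
  proof -
    have "x / \<rho> = be - al / \<rho> \<longleftrightarrow> x = be * \<rho> - al"
      using assms by (simp add: field_simps)
    also have "\<dots> \<longleftrightarrow> 2 * d * x = 2 * d * (be * \<rho> - al)"
      using pos by simp
    also have "2 * d * (be * \<rho> - al) = 2 * \<rho> * (d * be) - 2 * d * al"
      by (simp add: algebra_simps)
    also have "\<dots> = r\<^sup>2 + d\<^sup>2 - R\<^sup>2 + 2 * \<rho> * (r + R)"
      unfolding d_al d_be by (simp add: algebra_simps)
    finally show ?thesis .
  qed
  have 2: "D * (1 / \<rho> - p)\<^sup>2 + (y / \<rho>)\<^sup>2 = D * N\<^sup>2 \<longleftrightarrow> x\<^sup>2 + y\<^sup>2 = (r + \<rho>)\<^sup>2"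
    if "x / \<rho> = be - al / \<rho>"
  proof -
    have "D * (1 / \<rho> - p)\<^sup>2 + (y / \<rho>)\<^sup>2 = D * N\<^sup>2 \<longleftrightarrow> (x / \<rho>)\<^sup>2 + (y / \<rho>)\<^sup>2 = (r / \<rho> + 1)\<^sup>2"
      using polar_conic[of "1 / \<rho>" "1 / \<rho>"] unfolding that by (auto simp: power2_eq_square)
    also have "\<dots> \<longleftrightarrow> x\<^sup>2 + y\<^sup>2 = (r + \<rho>)\<^sup>2"
      using assms by (simp add: field_simps power2_eq_square)
    finally show ?thesis .
  qed
  have 3: "(x - d)\<^sup>2 + y\<^sup>2 = (R - \<rho>)\<^sup>2 \<longleftrightarrow> 2 * d * x = r\<^sup>2 + d\<^sup>2 - R\<^sup>2 + 2 * \<rho> * (r + R)"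
    if "x\<^sup>2 + y\<^sup>2 = (r + \<rho>)\<^sup>2"
    using that by (auto simp: power2_eq_square algebra_simps)
  show ?thesis
    using 1 2 3 by blast
qed

text \<open>Expanding with the two equations for tangency to the inner circle leaves \<open>(r +
  \<rho>) * (r + \<rho>') - x * x' - y * y' = 2 * \<rho> * \<rho>'\<close>. Division by
  \<open>\<rho> * \<rho>'\<close> then allows \<open>polar_conic\<close> to be applied.\<close>

lemma mutually_tangent_iff:
  assumes "0 < \<rho>" "0 < \<rho>'"
    and "x\<^sup>2 + y\<^sup>2 = (r + \<rho>)\<^sup>2" "x'\<^sup>2 + y'\<^sup>2 = (r + \<rho>')\<^sup>2"
    and "x / \<rho> = be - al / \<rho>" "x' / \<rho>' = be - al / \<rho>'"
  shows "(x - x')\<^sup>2 + (y - y')\<^sup>2 = (\<rho> + \<rho>')\<^sup>2 \<longleftrightarrow>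
    D * (1 / \<rho> - p) * (1 / \<rho>' - p) + (y / \<rho>) * (y' / \<rho>') = D * N\<^sup>2 - 2"
proof -
  have "(x - x')\<^sup>2 + (y - y')\<^sup>2 = (\<rho> + \<rho>')\<^sup>2 \<longleftrightarrow>
      (r + \<rho>) * (r + \<rho>') - x * x' - y * y' = 2 * (\<rho> * \<rho>')"
    using assms(3,4) by (auto simp: power2_eq_square algebra_simps)
  also have "\<dots> \<longleftrightarrow> ((r + \<rho>) * (r + \<rho>') - x * x' - y * y') / (\<rho> * \<rho>') = 2"
    using assms(1,2) by (simp add: divide_eq_eq)
  also have "((r + \<rho>) * (r + \<rho>') - x * x' - y * y') / (\<rho> * \<rho>') =
      (r / \<rho> + 1) * (r / \<rho>' + 1) - (x / \<rho>) * (x' / \<rho>') - (y / \<rho>) * (y' / \<rho>')"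
    using assms(1,2) by (simp add: field_simps)
  also have "\<dots> = D * N\<^sup>2 - D * (1 / \<rho> - p) * (1 / \<rho>' - p) - (y / \<rho>) * (y' / \<rho>')"
    using polar_conic[of "1 / \<rho>" "1 / \<rho>'"] unfolding assms(5,6) by simp
  finally show ?thesis by auto
qed

section \<open>Curvatures of an arbitrary chain\<close>

lemma chain_curvatures:
  assumes chain: "steiner_chain n A a R r c \<rho>" and dist: "dist A a = d"
  shows "\<exists>\<phi>. \<forall>j<n. 1 / \<rho> j = p - N * cos (\<phi> + 2 * pi * real j / real n)"
proof -
  define h where "h = 2 * pi / real n"
  have cos_h: "cos h = 1 - 2 / (D * N\<^sup>2)"
    unfolding h_def by (rule cos_step)
  \<comment> \<open>Multiplication by \<open>cnj e\<close> rotates the plane so that, seen from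
    \<open>a\<close>, the centre \<open>A\<close> lies at the real point \<open>d\<close>.\<close>
  define e where "e = (A - a) / of_real d"
  define z where "z j = (c j - a) * cnj e" for j
  have ne: "norm e = 1"
    using dist pos by (simp add: e_def norm_divide dist_norm)
  then have ee: "e * cnj e = 1"
    by (simp add: complex_norm_square[symmetric])
  have zd: "z j - of_real d = (c j - A) * cnj e" for j
  proof -
    have "(A - a) = of_real d * e" using pos by (simp add: e_def)
    then have "(A - a) * cnj e = of_real d" using ee by (simp add: mult.assoc)
    then show ?thesis by (simp add: z_def algebra_simps)
  qed
  have zz: "z i - z j = (c i - c j) * cnj e" for i j
    by (simp add: z_def algebra_simps)
  define x where "x j = Re (z j)" for j
  define y where "y j = Im (z j)" for j
  have \<rho>: "0 < \<rho> j" if "j < n" for j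
    using chain that by (auto simp: steiner_chain_def)
  have c1: "norm (c j - a) = r + \<rho> j" "norm (c j - A) = R - \<rho> j" if "j < n" for j
    using chain that
    by (auto simp: steiner_chain_def externally_tangent_def internally_tangent_def dist_norm)
  have c2: "norm (c j - c (Suc j)) = \<rho> j + \<rho> (Suc j)" if "Suc j < n" for j
  proof -
    have "externally_tangent (c j) (\<rho> j) (c (Suc j mod n)) (\<rho> (Suc j mod n))"
      using chain Suc_lessD[OF that] unfolding steiner_chain_def by blast
    then show ?thesis
      using that by (simp add: externally_tangent_def dist_norm)
  qed
  have sq: "(x j)\<^sup>2 + (y j)\<^sup>2 = (r + \<rho> j)\<^sup>2" "(x j - d)\<^sup>2 + (y j)\<^sup>2 = (R - \<rho> j)\<^sup>2" if "j < n" for j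
  proof -
    have "norm (z j) = r + \<rho> j" "norm (z j - of_real d) = R - \<rho> j"
      using c1[OF that] ne unfolding zd by (auto simp: z_def norm_mult)
    then show "(x j)\<^sup>2 + (y j)\<^sup>2 = (r + \<rho> j)\<^sup>2" "(x j - d)\<^sup>2 + (y j)\<^sup>2 = (R - \<rho> j)\<^sup>2"
      unfolding x_def y_def
      using cmod_power2[of "z j"] cmod_power2[of "z j - of_real d"] by auto
  qed
  have conic: "x j / \<rho> j = be - al / \<rho> j" "D * (1 / \<rho> j - p)\<^sup>2 + (y j / \<rho> j)\<^sup>2 = D * N\<^sup>2"
    if "j < n" for j
    using tangent_to_parents_iff[OF \<rho>[OF that], of "x j" "y j"] sq[OF that] by auto
  \<comment> \<open>The affine map carrying the ellipse to the unit circle; the sign of the real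
    part is chosen so that \<open>u j = cis \<psi>\<close> means
    \<open>1 / \<rho> j = p - N * cos \<psi>\<close>.\<close>
  define u where "u j = Complex ((p - 1 / \<rho> j) / N) (y j / \<rho> j / (N * sqrt D))" for j
  have Re_u: "Re (u i * cnj (u j)) =
      (D * (1 / \<rho> i - p) * (1 / \<rho> j - p) + (y i / \<rho> i) * (y j / \<rho> j)) / (D * N\<^sup>2)" for i j
  proof -
    have re: "Re (Complex s t * cnj (Complex v w)) = s * v + t * w" for s t v w
      by simp
    have alg: "(s / N) * (t / N) + v / (N * sqrt D) * (w / (N * sqrt D)) = (D * s * t + v * w) / (D * N\<^sup>2)"
      for s t v w
      using D_pos N_pos by (simp add: field_simps power2_eq_square)
    have "Re (u i * cnj (u j)) = (D * (p - 1 / \<rho> i) * (p - 1 / \<rho> j) + (y i / \<rho> i) * (y j / \<rho> j)) / (D * N\<^sup>2)"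
      unfolding u_def re alg by (rule refl)
    then show ?thesis by (simp add: algebra_simps)
  qed
  have nu: "norm (u j) = 1" if "j < n" for j
  proof -
    have "(norm (u j))\<^sup>2 = Re (u j * cnj (u j))"
      by (simp add: complex_mult_cnj cmod_power2)
    also have "\<dots> = 1"
      unfolding Re_u using conic(2)[OF that] D_pos N_pos by (simp add: power2_eq_square mult.assoc)
    finally show ?thesis
      using norm_ge_zero[of "u j"] unfolding power2_eq_1_iff by linarith
  qed
  have step: "u (Suc j) = u j * cis h \<or> u (Suc j) = u j * cis (- h)" if "Suc j < n" for j
  proof -
    have j: "j < n" using that by simp
    define w where "w = u j * cnj (u (Suc j))"
    have "norm w = 1"
      using nu[OF that] nu[OF j] by (simp add: w_def norm_mult)
    moreover have "Re w = cos h"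
    proof -
      have "norm (z j - z (Suc j)) = \<rho> j + \<rho> (Suc j)"
        using c2[OF that] ne by (simp add: zz norm_mult)
      then have "(x j - x (Suc j))\<^sup>2 + (y j - y (Suc j))\<^sup>2 = (\<rho> j + \<rho> (Suc j))\<^sup>2"
        unfolding x_def y_def using cmod_power2[of "z j - z (Suc j)"] by simp
      then have "Re w = (D * N\<^sup>2 - 2) / (D * N\<^sup>2)"
        unfolding w_def Re_u
        using mutually_tangent_iff[OF \<rho>[OF j] \<rho>[OF that] sq(1)[OF j] sq(1)[OF that]
            conic(1)[OF j] conic(1)[OF that]] by simp
      then show ?thesis
        using D_pos N_pos by (simp add: cos_h diff_divide_distrib)
    qed
    ultimately have "w = cis h \<or> w = cis (- h)"
      by (rule unimodular_eq_cis)
    moreover have "u (Suc j) = u j * cnj w"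
    proof -
      have "u j * cnj w = (u j * cnj (u j)) * u (Suc j)"
        by (simp add: w_def)
      then show ?thesis
        using nu[OF j] by (simp flip: complex_norm_square)
    qed
    ultimately show ?thesis by (auto simp: cis_cnj)
  qed
  \<comment> \<open>\<open>u j\<close> determines the radius and \<open>y j\<close>, and the affine
    relation then determines \<open>x j\<close>; equal values of \<open>u\<close> thus force equal
    centres.\<close>
  have inj: "inj_on u {..<n}"
  proof (rule inj_onI)
    fix i j assume ij: "i \<in> {..<n}" "j \<in> {..<n}" and eq: "u i = u j"
    have "\<rho> i = \<rho> j" "y i = y j"
      using eq N_pos D_pos \<rho>[of i] \<rho>[of j] ij by (auto simp: u_def)
    moreover from this have "x i / \<rho> j = x j / \<rho> j"
      using conic(1)[of i] conic(1)[of j] ij by simp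
    then have "x i = x j"
      using \<rho>[of j] ij by simp
    ultimately have "z i = z j"
      by (simp add: x_def y_def complex_eq_iff)
    then have "c i = c j"
      using zz[of i j] ne by auto
    moreover have "inj_on c {..<n}"
    proof (rule centres_distinct)
      show "goes_once_around n a c"
        using chain by (simp add: steiner_chain_def)
      show "c j \<noteq> a" if "j < n" for j
        using c1(1)[OF that] \<rho>[OF that] pos by auto
    qed
    ultimately show "i = j"
      using ij by (auto dest: inj_onD)
  qed
  obtain s where s: "s \<in> {1, - 1}" "\<And>j. j < n \<Longrightarrow> u j = u 0 * cis (s * real j * h)"
    using steps_without_backtracking[of n u h, OF step inj] by blast
  define \<phi> where "\<phi> = Arg (u 0)"
  have "u 0 = cis \<phi>"
    using nu[of 0] n cis_Arg[of "u 0"] by (cases "u 0 = 0") (auto simp: \<phi>_def sgn_div_norm)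
  then have "(p - 1 / \<rho> j) / N = cos (\<phi> + s * real j * h)" if "j < n" for j
    using arg_cong[OF s(2)[OF that], of Re] by (simp add: u_def cis_mult)
  then have b: "1 / \<rho> j = p - N * cos (\<phi> + s * real j * h)" if "j < n" for j
    using N_pos that by (simp add: field_simps)
  \<comment> \<open>Evenness of the cosine moves the direction of travel \<open>s\<close> into the
    phase, which becomes \<open>s * \<phi>\<close>.\<close>
  have "cos (\<phi> + s * real j * h) = cos (s * \<phi> + 2 * pi * real j / real n)" for j
  proof -
    have "2 * pi * real j / real n = real j * h"
      by (simp add: h_def)
    then show ?thesis
      using s(1) cos_minus[of "\<phi> - real j * h"] by auto
  qed
  then show ?thesis
    using b by (intro exI[of _ "s * \<phi>"]) simp
qed

section \<open>Existence of a chain\<close>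

text \<open>The definite description behind \<open>bending_moment\<close> needs a witness. The chain
  of phase 0 is built backwards from its curvatures, and both tangency equivalences are read from
  right to left.\<close>

lemma chain_exists:
  "\<exists>c \<rho>. steiner_chain n (of_real d) 0 R r c \<rho>"
proof -
  define h where "h = 2 * pi / real n"
  have cos_h: "cos h = 1 - 2 / (D * N\<^sup>2)"
    unfolding h_def by (rule cos_step)
  define b where "b j = p - N * cos (h * real j)" for j
  define Y where "Y j = N * sqrt D * sin (h * real j)" for j
  define \<rho> where "\<rho> j = 1 / b j" for j
  define x where "x j = (be - al * b j) * \<rho> j" for j
  define y where "y j = Y j * \<rho> j" for j
  define c where "c j = Complex (x j) (y j)" for j
  have b0: "0 < b j" for j
  proof -
    have "N * cos (h * real j) \<le> N * 1"
      using N_pos by (intro mult_left_mono) auto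
    then show ?thesis using N_less_p by (simp add: b_def)
  qed
  have \<rho>0: "0 < \<rho> j" for j using b0 by (simp add: \<rho>_def)
  have b\<rho>: "1 / \<rho> j = b j" "x j / \<rho> j = be - al / \<rho> j" "y j / \<rho> j = Y j" for j
    using b0[of j] by (auto simp: \<rho>_def x_def y_def)
  have "D * (b j - p)\<^sup>2 + (Y j)\<^sup>2 = D * N\<^sup>2" for j
  proof -
    have "D * (b j - p)\<^sup>2 + (Y j)\<^sup>2 = D * N\<^sup>2 * ((sin (h * real j))\<^sup>2 + (cos (h * real j))\<^sup>2)"
      using D_pos by (simp add: b_def Y_def power_mult_distrib algebra_simps del: sin_cos_squared_add2)
    then show ?thesis by simp
  qed
  then have sq: "(x j)\<^sup>2 + (y j)\<^sup>2 = (r + \<rho> j)\<^sup>2" "(x j - d)\<^sup>2 + (y j)\<^sup>2 = (R - \<rho> j)\<^sup>2" for j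
    using tangent_to_parents_iff[OF \<rho>0[of j], of "x j" "y j"] b\<rho>[of j] by auto
  have n1: "norm (c j) = r + \<rho> j" for j
    using sq(1)[of j] \<rho>0[of j] pos by (simp add: c_def cmod_def)
  have n2: "norm (c j - of_real d) = \<bar>R - \<rho> j\<bar>" for j
    using sq(2)[of j] by (simp add: c_def cmod_def)
  \<comment> \<open>The squared equation only yields \<open>\<bar>R - \<rho> j\<bar>\<close>; the
    triangle inequality with \<open>d + r < R\<close> excludes the other sign.\<close>
  have \<rho>R: "\<rho> j < R" for j
  proof (rule ccontr)
    assume "\<not> \<rho> j < R"
    then have "norm (c j - of_real d) = \<rho> j - R" using n2[of j] by simp
    moreover have "norm (c j) \<le> norm (c j - of_real d) + norm (complex_of_real d)"
      by norm
    ultimately show False using n1[of j] d_less pos by simp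
  qed
  have tang: "norm (c j - c (Suc j)) = \<rho> j + \<rho> (Suc j)" for j
  proof -
    have "D * (b j - p) * (b (Suc j) - p) + Y j * Y (Suc j) =
        D * N\<^sup>2 * (cos (h * real j) * cos (h * real (Suc j)) + sin (h * real j) * sin (h * real (Suc j)))"
      using D_pos by (simp add: b_def Y_def power2_eq_square algebra_simps)
    also have "\<dots> = D * N\<^sup>2 * cos (h * real j - h * real (Suc j))"
      by (simp only: cos_diff)
    also have "h * real j - h * real (Suc j) = - h"
      by (simp add: algebra_simps)
    also have "D * N\<^sup>2 * cos (- h) = D * N\<^sup>2 - 2"
      using D_pos N_pos by (simp add: cos_h algebra_simps)
    finally have "(x j - x (Suc j))\<^sup>2 + (y j - y (Suc j))\<^sup>2 = (\<rho> j + \<rho> (Suc j))\<^sup>2"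
      using mutually_tangent_iff[OF \<rho>0 \<rho>0 sq(1) sq(1) b\<rho>(2) b\<rho>(2)] b\<rho> by simp
    then show ?thesis
      using \<rho>0[of j] \<rho>0[of "Suc j"] by (simp add: c_def cmod_def)
  qed
  have hn: "h * real n = 2 * pi" using n by (simp add: h_def)
  have per: "c (Suc j mod n) = c (Suc j) \<and> \<rho> (Suc j mod n) = \<rho> (Suc j)" if "j < n" for j
  proof (cases "Suc j = n")
    case True
    have "b n = b 0" "Y n = Y 0"
      unfolding b_def Y_def hn by simp_all
    then show ?thesis using True by (simp add: c_def x_def y_def \<rho>_def)
  next
    case False
    then show ?thesis using that by simp
  qed
  \<comment> \<open>By \<open>r_p\<close> and \<open>al_p\<close>, the centre with ellipse angle
    \<open>t\<close> has polar angle with cosine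
    \<open>(cos t - \<kappa>) / (1 - \<kappa> * cos t)\<close> for this \<open>\<kappa>\<close>. The
    lift \<open>g\<close> thus turns equidistant ellipse angles into strictly increasing polar
    angles with total increase \<open>2 * pi\<close>.\<close>
  define \<kappa> where "\<kappa> = r / al"
  have \<kappa>: "0 < \<kappa>" "\<kappa> < 1" using al_gt pos by (auto simp: \<kappa>_def)
  obtain g where g: "strict_mono g" "\<And>t. g (t + 2 * pi) = g t + 2 * pi"
    and cg: "\<And>t. cos (g t) = (cos t - \<kappa>) / (1 - \<kappa> * cos t)"
    and sg: "\<And>t. sin (g t) = sqrt (1 - \<kappa>\<^sup>2) * sin t / (1 - \<kappa> * cos t)"
    using blaschke_angle[OF \<kappa>] by blast
  have al0: "0 < al" using al_gt pos by simp
  have al\<kappa>: "al * \<kappa> = r" using al0 by (simp add: \<kappa>_def)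
  have root: "al * sqrt (1 - \<kappa>\<^sup>2) = sqrt D"
  proof -
    have "sqrt D = sqrt (al\<^sup>2 * (1 - \<kappa>\<^sup>2))"
      unfolding D_def using al\<kappa> by (simp add: algebra_simps flip: power_mult_distrib)
    then show ?thesis using al0 by (simp add: real_sqrt_mult)
  qed
  have polar: "c j = of_real (norm (c j)) * cis (g (h * real j))" for j
  proof -
    define t where "t = h * real j"
    have nz: "0 < 1 - \<kappa> * cos t"
    proof -
      have "\<kappa> * cos t \<le> \<kappa> * 1" using \<kappa> by (intro mult_left_mono) auto
      then show ?thesis using \<kappa> by linarith
    qed
    have len: "r + \<rho> j = al * N * (1 - \<kappa> * cos t) * \<rho> j"
    proof -
      have "al * N * (1 - \<kappa> * cos t) = r * b j + 1"
        unfolding b_def t_def[symmetric] using r_p al\<kappa> by algebra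
      then show ?thesis using b0[of j] by (simp add: \<rho>_def field_simps)
    qed
    have "(r + \<rho> j) * cos (g t) = al * N * (cos t - \<kappa>) * \<rho> j"
      unfolding len cg using nz by simp
    also have "al * N * (cos t - \<kappa>) = be - al * b j"
      unfolding b_def t_def[symmetric] using al_p al\<kappa> by algebra
    finally have X: "(r + \<rho> j) * cos (g t) = x j" by (simp add: x_def)
    have "(r + \<rho> j) * sin (g t) = (al * sqrt (1 - \<kappa>\<^sup>2)) * N * sin t * \<rho> j"
      unfolding len sg using nz by simp
    then have "(r + \<rho> j) * sin (g t) = y j"
      unfolding root by (simp add: y_def Y_def t_def mult_ac)
    with X show ?thesis
      unfolding n1 by (simp add: complex_eq_iff t_def c_def)
  qed
  have "goes_once_around n 0 c"
    unfolding goes_once_around_def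
  proof (intro exI[of _ "\<lambda>j. g (h * real j)"] conjI disjI1 allI impI)
    show "g (h * real j) < g (h * real (Suc j))" for j
      by (rule strict_monoD[OF g(1)]) (use n in \<open>simp add: h_def field_simps\<close>)
    show "g (h * real n) = g (h * real 0) + 2 * pi"
      unfolding hn using g(2)[of 0] by simp
    show "c j - 0 = of_real (dist (c j) 0) * cis (g (h * real j))" for j
      using polar[of j] by simp
  qed
  moreover have "0 < \<rho> j \<and> externally_tangent (c j) (\<rho> j) 0 r \<and>
      internally_tangent (c j) (\<rho> j) (of_real d) R \<and>
      externally_tangent (c j) (\<rho> j) (c (Suc j mod n)) (\<rho> (Suc j mod n))" if "j < n" for j
    using per[OF that] n1[of j] n2[of j] \<rho>R[of j] \<rho>0[of j] tang[of j]
    by (simp add: externally_tangent_def internally_tangent_def dist_norm)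
  ultimately show ?thesis
    unfolding steiner_chain_def by blast
qed

section \<open>Bending moments as functions of the gauge\<close>

lemma parent_circles_standard: "parent_circles n (of_real d) 0 R r d"
proof -
  have "x \<in> ball (of_real d) R" if "x \<in> sphere 0 r" for x :: complex
  proof -
    have "norm (of_real d - x) \<le> norm (complex_of_real d) + norm x" by norm
    then show ?thesis using that d_less pos by (simp add: dist_norm)
  qed
  then show ?thesis
    using pos gauge by (auto simp: parent_circles_def)
qed

text \<open>All chains share one value by \<open>chain_curvatures\<close> and the power sum formula,
  and \<open>chain_exists\<close> shows that it is attained.\<close>

lemma bending_moment_eq:
  assumes "k < n"
  shows "bending_moment n k R r d = real n * moment_sum k p (N\<^sup>2) (\<lambda>x. x)"
  unfolding bending_moment_def
proof (rule the_equality)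
  have val: "chain_bending_moment n \<rho> k = real n * moment_sum k p (N\<^sup>2) (\<lambda>x. x)"
    if P: "parent_circles n A a R r d" and C: "steiner_chain n A a R r c \<rho>" for A a c \<rho>
  proof -
    obtain \<phi> where "\<forall>j<n. 1 / \<rho> j = p - N * cos (\<phi> + 2 * pi * real j / real n)"
      using chain_curvatures[OF C] P by (auto simp: parent_circles_def)
    then show ?thesis
      unfolding chain_bending_moment_def sum_power_equidistant[OF assms, symmetric, of _ _ \<phi>]
      by (intro sum.cong) auto
  qed
  then show "s = real n * moment_sum k p (N\<^sup>2) (\<lambda>x. x)"
    if "\<exists>A a c \<rho>. parent_circles n A a R r d \<and> steiner_chain n A a R r c \<rho> \<and>
        s = chain_bending_moment n \<rho> k" for s
    using that by blast
  show "\<exists>A a c \<rho>. parent_circles n A a R r d \<and> steiner_chain n A a R r c \<rho> \<and>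
        real n * moment_sum k p (N\<^sup>2) (\<lambda>x. x) = chain_bending_moment n \<rho> k"
    using parent_circles_standard chain_exists val by metis
qed

end

section \<open>The polynomial relation\<close>

lemma eval2_simps [simp]:
  "eval2 0 x y = 0" "eval2 1 x y = 1" "eval2 [:[:c:]:] x y = c"
  "eval2 (P + Q) x y = eval2 P x y + eval2 Q x y"
  "eval2 (P - Q) x y = eval2 P x y - eval2 Q x y"
  "eval2 (P * Q) x y = eval2 P x y * eval2 Q x y"
  "eval2 (P ^ m) x y = eval2 P x y ^ m"
  "eval2 (sum f S) x y = (\<Sum>i\<in>S. eval2 (f i) x y)"
  by (simp_all add: eval2_def poly_sum)

lemma eval2_moment_sum:
  "eval2 (moment_sum k P W (\<lambda>c. [:[:c:]:])) x y = moment_sum k (eval2 P x y) (eval2 W x y) (\<lambda>c. c)"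
  unfolding moment_sum_def eval2_simps(8)
proof (rule sum.cong)
  fix i
  show "eval2 (if even i
      then [:[:real ((k choose i) * (i choose (i div 2))) / 2 ^ i:]:] * P ^ (k - i) * W ^ (i div 2)
      else 0) x y =
    (if even i
      then real ((k choose i) * (i choose (i div 2))) / 2 ^ i * eval2 P x y ^ (k - i) *
        eval2 W x y ^ (i div 2)
      else 0)"
    by (cases "even i") (simp_all only: if_True if_False eval2_simps)
qed simp

theorem theorem5:
  fixes n k :: nat
  assumes "4 \<le> n" and "k \<in> {3..n - 1}"
  shows "\<exists>P :: real poly poly poly.
      0 < degree P \<and>
      (\<exists>A a R r d. parent_circles n A a R r d \<and>
         eval2 (lead_coeff P) (bending_moment n 1 R r d) (bending_moment n 2 R r d) \<noteq> 0) \<and>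
      (\<forall>A a R r d. parent_circles n A a R r d \<longrightarrow>
         eval3 P (bending_moment n 1 R r d) (bending_moment n 2 R r d)
           (bending_moment n k R r d) = 0)"
proof -
  \<comment> \<open>\<open>W\<close> is \<open>2 * Y / n - 2 * X^2 / n^2\<close>, obtained by
    solving \<open>I1 = n * p\<close> and \<open>I2 = n * (p^2 + N^2 / 2)\<close> for
    \<open>N^2\<close>.\<close>
  define W :: "real poly poly" where "W = [:[:0, 0, - 2 / (real n)\<^sup>2:], [:2 / real n:]:]"
  define Q where "Q = [:[:real n:]:] * moment_sum k [:[:0, 1 / real n:]:] W (\<lambda>c. [:[:c:]:])"
  \<comment> \<open>This is \<open>Z - Q\<close>, monic of degree one in \<open>Z\<close>, so its
    leading coefficient evaluates to 1 everywhere.\<close>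
  define P where "P = [:- Q, 1:]"
  have "eval3 P (bending_moment n 1 R r d) (bending_moment n 2 R r d) (bending_moment n k R r d) = 0"
    if "parent_circles n A a R r d" for A a R r d
  proof -
    interpret steiner_gauge n R r d
      using that assms by unfold_locales (auto simp: parent_circles_def)
    have I1: "bending_moment n 1 R r d = real n * p"
      using assms by (subst bending_moment_eq) (auto simp: moment_sum_def)
    have I2: "bending_moment n 2 R r d = real n * (p\<^sup>2 + N\<^sup>2 / 2)"
      using assms by (subst bending_moment_eq) (auto simp: moment_sum_def numeral_2_eq_2)
    have "eval2 [:[:0, 1 / real n:]:] (bending_moment n 1 R r d) (bending_moment n 2 R r d) = p"
      unfolding I1 using assms by (simp add: eval2_def)
    moreover have "eval2 W (bending_moment n 1 R r d) (bending_moment n 2 R r d) = N\<^sup>2"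
      unfolding I1 I2 W_def using assms by (simp add: eval2_def field_simps power2_eq_square)
    moreover have "k < n"
      using assms by auto
    ultimately have "eval2 Q (bending_moment n 1 R r d) (bending_moment n 2 R r d) =
        bending_moment n k R r d"
      by (simp only: Q_def eval2_simps eval2_moment_sum bending_moment_eq)
    then show ?thesis
      by (simp add: eval3_def P_def)
  qed
  \<comment> \<open>Nonvanishing must be witnessed by an actual pair. For \<open>n \<ge> 4\<close>
    the tangent is at most 1, so \<open>R = 10\<close> and \<open>r = 1\<close> give
    \<open>d^2 = 81 - 40 * t^2 > 0\<close>.\<close>
  moreover have "\<exists>A a R r d. parent_circles n A a R r d"
  proof -
    define t where "t = tan (pi / real n)"
    have "0 \<le> t" "t \<le> 1"
    proof -
      have a: "0 < pi / real n" "pi / real n \<le> pi / 4"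
        using assms by (auto simp: field_simps)
      have b: "pi / real n < pi / 2" using a(2) pi_gt_zero by linarith
      with a(1) show "0 \<le> t" unfolding t_def by (intro less_imp_le tan_gt_zero)
      show "t \<le> 1"
        unfolding t_def tan_45[symmetric] using a b pi_gt_zero by (subst tan_mono_le_eq) linarith+
    qed
    then have t: "t\<^sup>2 \<le> 1" by (simp add: power_le_one)
    define d where "d = sqrt (81 - 40 * t\<^sup>2)"
    have "d > 0" "d\<^sup>2 = 81 - 40 * t\<^sup>2" using t by (auto simp: d_def)
    then interpret steiner_gauge n 10 1 d
      using assms by unfold_locales (auto simp: t_def)
    show ?thesis using parent_circles_standard by blast
  qed
  ultimately show ?thesis
    by (intro exI[of _ P]) (auto simp: P_def)
qed

end
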